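(* Let $(X_i)_{i\ge 1}$ be a sequence of real-valued random variables that is bounded, i.e. there is a constant $M<\infty$ with $|X_i|\le M$ almost surely for all $i$. Let $\mathcal{F}_n=\sigma(X_1,\dots,X_n)$ for $n\ge 1$, let $\mathcal F_0$ be the trivial $\sigma$-algebra, and assume that for all $n\ge 1$, almost surely, $$\mathbb{E}[X_n\mid \mathcal{F}_{n-1}]=0,\qquad \mathbb{E}[X_n^2\mid\mathcal{F}_{n-1}]=1 .$$ Then for every sequence $(a_n)_n$ of positive real numbers with $a_n\to\infty$ and $a_n/\sqrt n\to 0$ as $n\to\infty$, the sequence of random variables $$\frac{1}{a_n\sqrt n}\sum_{i=1}^n X_i ,\qquad n\ge 1,$$ satisfies a moderate deviation principle with speed $a_n^2$ and rate function $I(x)=x^2/2$.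
   Context: A sequence of real random variables $(Y_n)_n$ satisfies a large deviation principle (LDP) with speed $v(n)$ (where $v(n)\to\infty$) and good rate function $I:\mathbb{R}\to[0,\infty]$ if: (i) for every $L\in[0,\infty)$ the level set $\{x\in\mathbb R: I(x)\le L\}$ is compact; (ii) for every open $G\subseteq\mathbb{R}$, $\liminf_{n\to\infty}\frac{1}{v(n)}\log\mathbb{P}(Y_n\in G)\ge-\inf_{x\in G}I(x)$; (iii) for every closed $A\subseteq\mathbb{R}$, $\limsup_{n\to\infty}\frac{1}{v(n)}\log\mathbb{P}(Y_n\in A)\le-\inf_{x\in A}I(x)$. Formally there is no distinction between a moderate deviation principle (MDP) and an LDP: "MDP with speed $v(n)$ and rate function $I$" means exactly that (i)--(iii) hold. *)

theory Defs
  imports "HOL-Probability.Probability"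
begin

text \<open>Extended logarithm of a probability, with the usual convention that the logarithm of 0
  is minus infinity (whereas the library has \<open>ln 0 = 0\<close> on the reals).\<close>

definition log_prob :: "real \<Rightarrow> ereal" where
  "log_prob p = (if p \<le> 0 then -\<infinity> else ereal (ln p))"

text \<open>Neither \<open>Y 0\<close> nor \<open>v 0\<close> is constrained: sequences are indexed by \<open>n \<ge> 1\<close>.
  \<open>Inf\<close> over the empty set is \<open>\<infinity>\<close> in \<open>ereal\<close>, as the bounds require.\<close>

definition satisfies_LDP ::
  "'a measure \<Rightarrow> (nat \<Rightarrow> 'a \<Rightarrow> real) \<Rightarrow> (nat \<Rightarrow> real) \<Rightarrow> (real \<Rightarrow> ereal) \<Rightarrow> bool" where
  "satisfies_LDP M Y v I \<longleftrightarrow>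
     (\<forall>n\<ge>1. Y n \<in> borel_measurable M) \<and>
     filterlim v at_top sequentially \<and>
     (\<forall>x. 0 \<le> I x) \<and>
     (\<forall>L::real. 0 \<le> L \<longrightarrow> compact {x. I x \<le> ereal L}) \<and>
     (\<forall>G. open G \<longrightarrow>
        - (INF x\<in>G. I x)
          \<le> liminf (\<lambda>n. ereal (1 / v n) * log_prob (measure M {\<omega> \<in> space M. Y n \<omega> \<in> G}))) \<and>
     (\<forall>A. closed A \<longrightarrow>
        limsup (\<lambda>n. ereal (1 / v n) * log_prob (measure M {\<omega> \<in> space M. Y n \<omega> \<in> A}))
          \<le> - (INF x\<in>A. I x))"

text \<open>Formally there is no distinction between an MDP and an LDP.\<close>

abbreviation satisfies_MDP ::
  "'a measure \<Rightarrow> (nat \<Rightarrow> 'a \<Rightarrow> real) \<Rightarrow> (nat \<Rightarrow> real) \<Rightarrow> (real \<Rightarrow> ereal) \<Rightarrow> bool" where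
  "satisfies_MDP \<equiv> satisfies_LDP"

text \<open>The \<open>\<sigma>\<close>-algebra on \<open>space M\<close> generated by \<open>X 1, \<dots>, X n\<close>; it is trivial for \<open>n = 0\<close>.
  A supremum of \<open>vimage_algebra\<close>s would not do, since it has empty space for \<open>n = 0\<close>.\<close>

definition natural_filtration :: "'a measure \<Rightarrow> (nat \<Rightarrow> 'a \<Rightarrow> real) \<Rightarrow> nat \<Rightarrow> 'a measure" where
  "natural_filtration M X n =
     sigma (space M) (\<Union>i\<in>{1..n}. {X i -` A \<inter> space M | A. A \<in> sets borel})"

lemma space_natural_filtration [simp]: "space (natural_filtration M X n) = space M"
  by (simp add: natural_filtration_def space_measure_of_conv)

lemma sets_natural_filtration_0: "sets (natural_filtration M X 0) = {{}, space M}"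
  by (simp add: natural_filtration_def sigma_sets_empty_eq)

lemma subalgebra_natural_filtration:
  assumes "\<And>i. 1 \<le> i \<Longrightarrow> i \<le> n \<Longrightarrow> X i \<in> borel_measurable M"
  shows "subalgebra M (natural_filtration M X n)"
proof -
  have *: "(\<Union>i\<in>{1..n}. {X i -` A \<inter> space M | A. A \<in> sets borel}) \<subseteq> sets M"
    using assms by (auto intro: measurable_sets)
  then have "(\<Union>i\<in>{1..n}. {X i -` A \<inter> space M | A. A \<in> sets borel}) \<subseteq> Pow (space M)"
    using sets.sets_into_space by blast
  with * show ?thesis
    by (simp add: subalgebra_def natural_filtration_def space_measure_of_conv
        sets.sigma_sets_subset del: One_nat_def)
qed

end

theory Submission
  imports Defs
begin

text \<open>With \<open>l = t a\<^sub>n / sqrt n\<close>, conditioning multiplies \<open>E exp (l S\<^sub>k)\<close> by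
  \<open>1 + l\<^sup>2/2 + O(\<bar>l\<bar>\<^sup>3)\<close> at each step \<open>k\<close>, so the logarithmic moment generating function of
  \<open>S\<^sub>n / (a\<^sub>n sqrt n)\<close>, scaled by the speed \<open>a\<^sub>n\<^sup>2\<close>, converges to \<open>t\<^sup>2/2\<close>. This is the Gaussian case
  of the Gaertner-Ellis theorem. Its upper bound is Chernoff's inequality. For the lower bound no
  change of measure is needed: up to an exponentially small fraction, the expectation
  \<open>E exp (v x Y)\<close> is carried by the event \<open>\<bar>Y - x\<bar> < d\<close>, since on the complement one may
  compare with the parameters \<open>x + d\<close> and \<open>x - d\<close>, which gains a factor \<open>exp (- v d\<^sup>2/2)\<close>.\<close>

section \<open>Exponential bounds on probabilities at logarithmic scale\<close>

lemma scaled_log_prob_le: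
  assumes "v > 0" "p \<le> exp (v * c)"
  shows "ereal (1 / v) * log_prob p \<le> ereal c"
proof (cases "p \<le> 0")
  case True
  then show ?thesis using assms by (simp add: log_prob_def)
next
  case False
  then have "ln p \<le> v * c"
    using assms(2) by (metis exp_le_cancel_iff exp_ln not_le)
  then show ?thesis
    using False assms(1) by (simp add: log_prob_def field_simps)
qed

text \<open>The exponential lower bound itself forces \<open>p > 0\<close>, so the value
  -\<infinity> of \<open>log_prob\<close> cannot occur here. In the upper estimate that value does
  occur, and there it is harmless.\<close>

lemma scaled_log_prob_ge:
  assumes "v > 0" "exp (v * c) \<le> p"
  shows "ereal c \<le> ereal (1 / v) * log_prob p"
proof -
  have "p > 0" using assms(2) exp_gt_zero[of "v * c"] by linarith
  then have "v * c \<le> ln p"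
    using assms(2) by (metis exp_le_cancel_iff exp_ln)
  then show ?thesis
    using \<open>p > 0\<close> assms(1) by (simp add: log_prob_def field_simps)
qed

section \<open>Gaertner-Ellis theorem for a Gaussian limit\<close>

locale gaussian_log_mgf = prob_space M
  for M :: "'a measure" +
  fixes Y :: "nat \<Rightarrow> 'a \<Rightarrow> real" and v :: "nat \<Rightarrow> real"
  assumes measurable_Y: "n \<ge> 1 \<Longrightarrow> Y n \<in> borel_measurable M"
    and integrable_exp: "n \<ge> 1 \<Longrightarrow> integrable M (\<lambda>\<omega>. exp (v n * t * Y n \<omega>))"
    and speed: "filterlim v at_top sequentially"
    and log_mgf_limit: "(\<lambda>n. ln (expectation (\<lambda>\<omega>. exp (v n * t * Y n \<omega>))) / v n) \<longlonglongrightarrow> t\<^sup>2 / 2"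
begin

abbreviation mgf :: "nat \<Rightarrow> real \<Rightarrow> real" where
  "mgf n t \<equiv> expectation (\<lambda>\<omega>. exp (v n * t * Y n \<omega>))"

lemma eventually_speed_pos: "\<forall>\<^sub>F n in sequentially. n \<ge> 1 \<and> v n > 0"
  using eventually_ge_at_top[of 1] filterlim_at_top_dense[THEN iffD1, OF speed, rule_format, of 0]
  by eventually_elim auto

text \<open>Lets constant factors, which arise from adding two exponentials or from halving, be
  absorbed into an arbitrarily small change \<open>e\<close> of the exponent.\<close>

lemma eventually_two_le_exp:
  assumes "e > 0"
  shows "\<forall>\<^sub>F n in sequentially. 2 \<le> exp (v n * e)"
proof -
  have "\<forall>\<^sub>F n in sequentially. v n \<ge> ln 2 / e"
    using speed by (simp add: filterlim_at_top)
  then show ?thesis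
  proof eventually_elim
    case (elim n)
    then have "ln 2 \<le> v n * e" using assms by (simp add: field_simps)
    then show ?case by (metis exp_le_cancel_iff exp_ln zero_less_numeral)
  qed
qed

text \<open>A nonnegative function with integral 0 vanishes almost everywhere, which an exponential
  never does. Positivity is what allows \<open>ln\<close> to be undone by
  \<open>exp\<close>.\<close>

lemma mgf_pos:
  assumes "n \<ge> 1"
  shows "mgf n t > 0"
proof -
  have "mgf n t \<noteq> 0"
  proof
    assume "mgf n t = 0"
    then have "AE \<omega> in M. exp (v n * t * Y n \<omega>) = 0"
      using integral_nonneg_eq_0_iff_AE[OF integrable_exp[OF assms]] by simp
    then show False by simp
  qed
  moreover have "mgf n t \<ge> 0" by (rule integral_nonneg_AE) simp
  ultimately show ?thesis by linarith
qed

text \<open>The limit of the logarithms in multiplicative form, the form in which both large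
  deviation bounds use it.\<close>

lemma eventually_mgf_bounds:
  assumes "e > 0"
  shows "\<forall>\<^sub>F n in sequentially.
    exp (v n * (t\<^sup>2 / 2 - e)) \<le> mgf n t \<and> mgf n t \<le> exp (v n * (t\<^sup>2 / 2 + e))"
proof -
  have "\<forall>\<^sub>F n in sequentially. dist (ln (mgf n t) / v n) (t\<^sup>2 / 2) < e"
    using tendstoD[OF log_mgf_limit assms] .
  with eventually_speed_pos show ?thesis
  proof eventually_elim
    case (elim n)
    then have "v n * (t\<^sup>2 / 2 - e) \<le> ln (mgf n t)" "ln (mgf n t) \<le> v n * (t\<^sup>2 / 2 + e)"
      by (auto simp: dist_real_def abs_less_iff field_simps)
    then show ?case
      using mgf_pos[of n t] elim by (metis exp_le_cancel_iff exp_ln)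
  qed
qed

section \<open>Upper bound for closed sets\<close>

text \<open>Chernoff's inequality for both tails at once: exp (v r (|y| - r)) is at least 1 on
  \<open>A\<close>, and exp (v r |y|) is at most the sum of the exponentials with parameters
  \<open>r\<close> and \<open>- r\<close>. The parameter equals the threshold because t = r
  minimises t^2/2 - t r.\<close>

lemma tail_bound:
  assumes "n \<ge> 1" "v n > 0" "r \<ge> 0" "A \<in> sets borel" "\<And>y. y \<in> A \<Longrightarrow> r \<le> \<bar>y\<bar>"
  shows "prob {\<omega> \<in> space M. Y n \<omega> \<in> A} \<le> exp (- v n * r\<^sup>2) * (mgf n r + mgf n (- r))"
proof -
  note [measurable] = measurable_Y[OF assms(1)] assms(4)
  have "indicator {\<omega> \<in> space M. Y n \<omega> \<in> A} \<omega> \<le>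
      exp (- v n * r\<^sup>2) * (exp (v n * r * Y n \<omega>) + exp (v n * (- r) * Y n \<omega>))" for \<omega>
  proof (cases "Y n \<omega> \<in> A")
    case True
    then have r: "r \<le> \<bar>Y n \<omega>\<bar>" using assms(5) by blast
    have "1 \<le> exp (v n * r * (\<bar>Y n \<omega>\<bar> - r))"
      using assms(2,3) r by simp
    also have "\<dots> = exp (- v n * r\<^sup>2) * exp (v n * r * \<bar>Y n \<omega>\<bar>)"
      by (simp add: exp_add[symmetric] algebra_simps power2_eq_square)
    also have "\<dots> \<le> exp (- v n * r\<^sup>2) * (exp (v n * r * Y n \<omega>) + exp (v n * (- r) * Y n \<omega>))"
      by (intro mult_left_mono) (auto simp: abs_if)
    finally show ?thesis by (auto simp: indicator_def)
  qed (simp add: indicator_def add_nonneg_nonneg)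
  then have "expectation (indicator {\<omega> \<in> space M. Y n \<omega> \<in> A}) \<le>
      expectation (\<lambda>\<omega>. exp (- v n * r\<^sup>2) * (exp (v n * r * Y n \<omega>) + exp (v n * (- r) * Y n \<omega>)))"
    using integrable_exp[OF assms(1), of r] integrable_exp[OF assms(1), of "- r"]
    by (intro integral_mono) (auto simp: less_top[symmetric])
  also have "\<dots> = exp (- v n * r\<^sup>2) * (mgf n r + mgf n (- r))"
    using integrable_exp[OF assms(1), of r] integrable_exp[OF assms(1), of "- r"]
    by (subst integral_mult_right_zero, subst Bochner_Integration.integral_add) auto
  finally show ?thesis by simp
qed

lemma upper_bound:
  assumes "closed A"
  shows "limsup (\<lambda>n. ereal (1 / v n) * log_prob (prob {\<omega> \<in> space M. Y n \<omega> \<in> A}))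
    \<le> - (INF x\<in>A. ereal (x\<^sup>2 / 2))" (is "limsup ?f \<le> _")
proof (cases "A = {}")
  case True
  \<comment> \<open>The infimum over the empty set is \<infinity>, so the limit superior must be
    -\<infinity>; the probability is 0 and the speed is eventually positive.\<close>
  have "\<forall>\<^sub>F n in sequentially. ?f n \<le> -\<infinity>"
    using eventually_speed_pos by eventually_elim (simp add: True log_prob_def)
  then have "limsup ?f \<le> -\<infinity>" by (rule Limsup_bounded)
  then show ?thesis by (simp add: True top_ereal_def)
next
  case False
  \<comment> \<open>A closed nonempty set has a point nearest to the origin, and this point
    minimises x^2/2 on \<open>A\<close>.\<close>
  then obtain x where x: "x \<in> A" "infdist 0 A = dist 0 x"
    using infdist_attains_inf[OF assms] by metis
  define r where "r = \<bar>x\<bar>"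
  have r: "r \<le> \<bar>y\<bar>" if "y \<in> A" for y
    using infdist_le[OF that, of 0] x(2) by (simp add: r_def dist_real_def)
  \<comment> \<open>One half of the slack \<open>e\<close> pays for the approximation of the
    generating function, the other half for the factor 2 from the two tails.\<close>
  have "limsup ?f \<le> ereal (- (r\<^sup>2 / 2)) + ereal e" if e: "e > 0" for e :: real
  proof -
    have "\<forall>\<^sub>F n in sequentially. ?f n \<le> ereal (- (r\<^sup>2 / 2) + e)"
      using eventually_speed_pos eventually_mgf_bounds[OF half_gt_zero[OF e], of r]
        eventually_mgf_bounds[OF half_gt_zero[OF e], of "- r"]
        eventually_two_le_exp[OF half_gt_zero[OF e]]
    proof eventually_elim
      case (elim n)
      have "prob {\<omega> \<in> space M. Y n \<omega> \<in> A} \<le> exp (- v n * r\<^sup>2) * (mgf n r + mgf n (- r))"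
        using elim assms r by (intro tail_bound) (auto simp: r_def)
      also have "\<dots> \<le> exp (- v n * r\<^sup>2) * (exp (v n * (e / 2)) * exp (v n * (r\<^sup>2 / 2 + e / 2)))"
      proof (intro mult_left_mono)
        have "mgf n r + mgf n (- r) \<le> 2 * exp (v n * (r\<^sup>2 / 2 + e / 2))" using elim by simp
        also have "\<dots> \<le> exp (v n * (e / 2)) * exp (v n * (r\<^sup>2 / 2 + e / 2))"
          using elim by (intro mult_right_mono) auto
        finally show "mgf n r + mgf n (- r) \<le> exp (v n * (e / 2)) * exp (v n * (r\<^sup>2 / 2 + e / 2))" .
      qed simp
      also have "\<dots> = exp (v n * (- (r\<^sup>2 / 2) + e))"
        by (simp add: exp_add[symmetric] field_simps)
      finally show ?case using elim by (intro scaled_log_prob_le) auto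
    qed
    then show ?thesis by (auto intro: Limsup_bounded)
  qed
  then have "limsup ?f \<le> ereal (- (r\<^sup>2 / 2))"
    by (rule ereal_le_epsilon2)
  also have "\<dots> \<le> - (INF x\<in>A. ereal (x\<^sup>2 / 2))"
    using INF_lower[OF x(1), of "\<lambda>x. ereal (x\<^sup>2 / 2)"]
    by (subst ereal_minus_le_minus[symmetric]) (simp add: r_def)
  finally show ?thesis .
qed

section \<open>Lower bound for open sets\<close>

text \<open>Pointwise, with y the value of \<open>Y n\<close>: inside the ball, x y is at most x^2 +
  |x| d. For y \<ge> x + d the factor exp (v d (y - (x + d))) is at least 1, and multiplying by it
  shifts the parameter from \<open>x\<close> to \<open>x + d\<close>; symmetrically for y \<le> x -
  d.\<close>

lemma mgf_le_prob_ball: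
  assumes "n \<ge> 1" "v n > 0" "d > 0"
  shows "mgf n x \<le> exp (v n * (x\<^sup>2 + \<bar>x\<bar> * d)) * prob {\<omega> \<in> space M. Y n \<omega> \<in> ball x d}
    + exp (- v n * d * (x + d)) * mgf n (x + d) + exp (v n * d * (x - d)) * mgf n (x - d)"
proof -
  note [measurable] = measurable_Y[OF assms(1)]
  note int = integrable_exp[OF assms(1)]
  let ?S = "{\<omega> \<in> space M. Y n \<omega> \<in> ball x d}"
  have S [measurable]: "?S \<in> sets M"
    using measurable_sets[OF measurable_Y[OF assms(1)], of "ball x d"]
    by (simp add: vimage_def Int_def conj_commute)
  have "exp (v n * x * Y n \<omega>) \<le> exp (v n * (x\<^sup>2 + \<bar>x\<bar> * d)) * indicator ?S \<omega>
      + exp (- v n * d * (x + d)) * exp (v n * (x + d) * Y n \<omega>)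
      + exp (v n * d * (x - d)) * exp (v n * (x - d) * Y n \<omega>)" (is "_ \<le> ?a + ?b + ?c")
    if "\<omega> \<in> space M" for \<omega>
  proof -
    have b: "?b = exp (v n * x * Y n \<omega> + v n * d * (Y n \<omega> - (x + d)))"
      and c: "?c = exp (v n * x * Y n \<omega> + v n * d * (x - d - Y n \<omega>))"
      by (simp_all add: exp_add[symmetric] algebra_simps)
    consider "Y n \<omega> \<ge> x + d" | "Y n \<omega> \<le> x - d" | "\<bar>Y n \<omega> - x\<bar> < d" by linarith
    then show ?thesis
    proof cases
      case 1
      then have "exp (v n * x * Y n \<omega>) \<le> ?b" unfolding b using assms by simp
      moreover have "?a \<ge> 0" "?c \<ge> 0" by simp_all
      ultimately show ?thesis by linarith
    next
      case 2
      then have "exp (v n * x * Y n \<omega>) \<le> ?c" unfolding c using assms by simp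
      moreover have "?a \<ge> 0" "?b \<ge> 0" by simp_all
      ultimately show ?thesis by linarith
    next
      case 3
      have "x * (Y n \<omega> - x) \<le> \<bar>x\<bar> * \<bar>Y n \<omega> - x\<bar>"
        by (metis abs_ge_self abs_mult)
      also have "\<dots> \<le> \<bar>x\<bar> * d" using 3 by (intro mult_left_mono) auto
      finally have "v n * (x * Y n \<omega>) \<le> v n * (x\<^sup>2 + \<bar>x\<bar> * d)"
        using assms by (intro mult_left_mono) (auto simp: algebra_simps power2_eq_square)
      moreover have "\<omega> \<in> ?S" using 3 that by (simp add: dist_real_def)
      ultimately have "exp (v n * x * Y n \<omega>) \<le> ?a" by (simp add: mult.assoc)
      moreover have "?b \<ge> 0" "?c \<ge> 0" by simp_all
      ultimately show ?thesis by linarith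
    qed
  qed
  then have "mgf n x \<le> expectation (\<lambda>\<omega>. exp (v n * (x\<^sup>2 + \<bar>x\<bar> * d)) * indicator ?S \<omega>
      + exp (- v n * d * (x + d)) * exp (v n * (x + d) * Y n \<omega>)
      + exp (v n * d * (x - d)) * exp (v n * (x - d) * Y n \<omega>))"
    by (intro integral_mono int Bochner_Integration.integrable_add integrable_mult_right
        integrable_real_indicator S) (auto simp: less_top[symmetric])
  also have "\<dots> = exp (v n * (x\<^sup>2 + \<bar>x\<bar> * d)) * expectation (indicator ?S)
      + exp (- v n * d * (x + d)) * mgf n (x + d) + exp (v n * d * (x - d)) * mgf n (x - d)"
    by (subst Bochner_Integration.integral_add, (intro int Bochner_Integration.integrable_add
          integrable_mult_right integrable_real_indicator S; simp add: less_top[symmetric])+)+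
      simp
  finally show ?thesis using S by simp
qed

lemma lower_bound:
  assumes "open G"
  shows "- (INF x\<in>G. ereal (x\<^sup>2 / 2))
    \<le> liminf (\<lambda>n. ereal (1 / v n) * log_prob (prob {\<omega> \<in> space M. Y n \<omega> \<in> G}))"
    (is "_ \<le> liminf ?f")
proof -
  \<comment> \<open>In negated form the claim splits into one estimate for each point of
    \<open>G\<close>, since an infimum is a greatest lower bound.\<close>
  have "- liminf ?f \<le> ereal (x\<^sup>2 / 2)" if "x \<in> G" for x
  proof (rule ereal_le_epsilon2)
    fix h :: real assume h: "h > 0"
    obtain d0 where d0: "d0 > 0" "ball x d0 \<subseteq> G"
      using assms \<open>x \<in> G\<close> open_contains_ball by blast
    \<comment> \<open>The radius makes |x| d at most h/2; adding 1 keeps the denominator positive at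
      x = 0.\<close>
    define d where "d = min d0 (h / (2 * (\<bar>x\<bar> + 1)))"
    have d: "d > 0" "d \<le> d0" using d0 h by (auto simp: d_def)
    have "\<bar>x\<bar> * d \<le> (\<bar>x\<bar> + 1) * (h / (2 * (\<bar>x\<bar> + 1)))"
      using d by (intro mult_mono) (auto simp: d_def)
    also have "\<dots> = h / 2" by (simp add: field_simps)
    finally have xd: "\<bar>x\<bar> * d \<le> h / 2" .
    \<comment> \<open>The first term keeps the approximation errors below the gain d^2/2 outside the
      ball; the second leaves a total loss of at most \<open>h\<close> in the exponent.\<close>
    define e where "e = min (d\<^sup>2 / 8) (h / 4)"
    have e: "e > 0" "4 * e \<le> d\<^sup>2 / 2" "2 * e \<le> h / 2" using d h by (auto simp: e_def)
    have "\<forall>\<^sub>F n in sequentially. ereal (- (x\<^sup>2 / 2) - h) \<le> ?f n"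
      using eventually_speed_pos eventually_mgf_bounds[OF e(1), of x]
        eventually_mgf_bounds[OF e(1), of "x + d"] eventually_mgf_bounds[OF e(1), of "x - d"]
        eventually_two_le_exp[OF e(1)]
    proof eventually_elim
      case (elim n)
      let ?P = "prob {\<omega> \<in> space M. Y n \<omega> \<in> ball x d}"
      let ?E = "exp (v n * (x\<^sup>2 / 2 - e))"
      have v: "v n > 0" using elim by simp
      have q: "exp (- (v n * (2 * e))) \<le> 1 / 4"
      proof -
        have "2 * 2 \<le> exp (v n * e) * exp (v n * e)" using elim by (intro mult_mono) auto
        also have "\<dots> = exp (v n * (2 * e))" by (simp add: exp_add[symmetric])
        finally show ?thesis by (simp add: exp_minus field_simps)
      qed
      \<comment> \<open>Covers both shifted parameters: -d (x + d) + (x + d)^2/2 and d (x - d) + (x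
        - d)^2/2 both equal (x^2 - d^2)/2.\<close>
      have small: "exp (w + v n * (y\<^sup>2 / 2 + e)) \<le> ?E / 4"
        if "w + v n * (y\<^sup>2 / 2) = v n * (x\<^sup>2 / 2 - d\<^sup>2 / 2)" for w y
      proof -
        have "w + v n * (y\<^sup>2 / 2 + e) = v n * (x\<^sup>2 / 2 - d\<^sup>2 / 2 + e)"
          using that by (simp add: algebra_simps)
        also have "\<dots> \<le> v n * (x\<^sup>2 / 2 - 3 * e)"
          using e v by (intro mult_left_mono) auto
        also have "\<dots> = v n * (x\<^sup>2 / 2 - e) + - (v n * (2 * e))" by (simp add: algebra_simps)
        finally have "exp (w + v n * (y\<^sup>2 / 2 + e)) \<le> ?E * exp (- (v n * (2 * e)))"
          by (simp only: exp_add[symmetric] exp_le_cancel_iff)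
        also have "\<dots> \<le> ?E * (1 / 4)" using q by (intro mult_left_mono) auto
        finally show ?thesis by simp
      qed
      have "exp (- v n * d * (x + d)) * mgf n (x + d)
          \<le> exp (- v n * d * (x + d)) * exp (v n * ((x + d)\<^sup>2 / 2 + e))"
        using elim by (intro mult_left_mono) auto
      also have "\<dots> \<le> ?E / 4" unfolding exp_add[symmetric]
        by (intro small) (simp add: field_simps power2_eq_square)
      finally have 1: "exp (- v n * d * (x + d)) * mgf n (x + d) \<le> ?E / 4" .
      have "exp (v n * d * (x - d)) * mgf n (x - d)
          \<le> exp (v n * d * (x - d)) * exp (v n * ((x - d)\<^sup>2 / 2 + e))"
        using elim by (intro mult_left_mono) auto
      also have "\<dots> \<le> ?E / 4" unfolding exp_add[symmetric]
        by (intro small) (simp add: field_simps power2_eq_square)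
      finally have 2: "exp (v n * d * (x - d)) * mgf n (x - d) \<le> ?E / 4" .
      \<comment> \<open>The two outer terms take at most a quarter of \<open>?E\<close> each, so at
        least half of it remains for the ball.\<close>
      have "?E \<le> mgf n x" using elim by simp
      with mgf_le_prob_ball[of n d x] elim d 1 2
      have 3: "?E / 2 \<le> exp (v n * (x\<^sup>2 + \<bar>x\<bar> * d)) * ?P" by auto
      \<comment> \<open>A further \<open>e\<close> in the exponent removes the factor 1/2.\<close>
      have "exp (v n * (x\<^sup>2 / 2 - 2 * e)) * 2 \<le> exp (v n * (x\<^sup>2 / 2 - 2 * e)) * exp (v n * e)"
        using elim by (intro mult_left_mono) auto
      also have "\<dots> = ?E" by (simp add: exp_add[symmetric] algebra_simps)
      finally have "exp (v n * (x\<^sup>2 / 2 - 2 * e)) \<le> exp (v n * (x\<^sup>2 + \<bar>x\<bar> * d)) * ?P"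
        using 3 by simp
      then have "exp (- (v n * (x\<^sup>2 + \<bar>x\<bar> * d))) * exp (v n * (x\<^sup>2 / 2 - 2 * e)) \<le> ?P"
        unfolding exp_minus by (simp only: inverse_eq_divide mult.left_neutral times_divide_eq_left
            pos_divide_le_eq exp_gt_zero mult.commute)
      also have "exp (- (v n * (x\<^sup>2 + \<bar>x\<bar> * d))) * exp (v n * (x\<^sup>2 / 2 - 2 * e))
          = exp (v n * (- (x\<^sup>2 / 2) - \<bar>x\<bar> * d - 2 * e))"
        by (simp add: exp_add[symmetric] field_simps)
      finally have "exp (v n * (- (x\<^sup>2 / 2) - \<bar>x\<bar> * d - 2 * e)) \<le> ?P" .
      moreover have "exp (v n * (- (x\<^sup>2 / 2) - h)) \<le> exp (v n * (- (x\<^sup>2 / 2) - \<bar>x\<bar> * d - 2 * e))"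
        using v xd e by (simp add: mult_left_mono)
      moreover have "?P \<le> prob {\<omega> \<in> space M. Y n \<omega> \<in> G}"
      proof (rule finite_measure_mono)
        show "{\<omega> \<in> space M. Y n \<omega> \<in> ball x d} \<subseteq> {\<omega> \<in> space M. Y n \<omega> \<in> G}"
          using d0 d by auto
        have "G \<in> sets borel" using assms by simp
        then show "{\<omega> \<in> space M. Y n \<omega> \<in> G} \<in> sets M"
          using measurable_sets[OF measurable_Y] elim by (simp add: vimage_def Int_def conj_commute)
      qed
      ultimately show ?case using v by (intro scaled_log_prob_ge) linarith+
    qed
    then have "ereal (- (x\<^sup>2 / 2) - h) \<le> liminf ?f" by (rule Liminf_bounded)
    then have "- liminf ?f \<le> - ereal (- (x\<^sup>2 / 2) - h)"
      by (simp only: ereal_minus_le_minus)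
    then show "- liminf ?f \<le> ereal (x\<^sup>2 / 2) + ereal h" by (simp add: algebra_simps)
  qed
  then have "- liminf ?f \<le> (INF x\<in>G. ereal (x\<^sup>2 / 2))" by (rule INF_greatest)
  then show ?thesis by (simp add: ereal_uminus_le_reorder)
qed

theorem LDP: "satisfies_LDP M Y v (\<lambda>x. ereal (x\<^sup>2 / 2))"
proof -
  have "compact {x. ereal (x\<^sup>2 / 2) \<le> ereal L}" for L :: real
  proof -
    \<comment> \<open>No sign condition on \<open>L\<close>: \<open>sqrt\<close> is odd and strictly
      increasing on all reals, so for negative \<open>L\<close> the interval below is empty.\<close>
    have "x\<^sup>2 / 2 \<le> L \<longleftrightarrow> \<bar>x\<bar> \<le> sqrt (2 * L)" for x
      using real_sqrt_le_iff[of "x\<^sup>2" "2 * L"] by (simp add: mult.commute)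
    then have "{x. ereal (x\<^sup>2 / 2) \<le> ereal L} = {- sqrt (2 * L)..sqrt (2 * L)}"
      by (intro set_eqI)
        (simp only: mem_Collect_eq ereal_less_eq abs_le_iff atLeastAtMost_iff; linarith)
    then show ?thesis by simp
  qed
  then show ?thesis
    unfolding satisfies_LDP_def using measurable_Y speed lower_bound upper_bound by auto
qed

end

section \<open>Taylor error of the exponential and measurability in the filtration\<close>

text \<open>The Lagrange remainder is exp t / 6 times u^3 with |t| \<le> 1, and exp 1 \<le> 3 makes
  its coefficient at most 1/2, rounded up to 1.\<close>

lemma exp_quadratic_error:
  fixes u :: real
  assumes "\<bar>u\<bar> \<le> 1"
  shows "\<bar>exp u - (1 + u + u\<^sup>2 / 2)\<bar> \<le> \<bar>u\<bar> ^ 3"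
proof -
  obtain t where t: "\<bar>t\<bar> \<le> \<bar>u\<bar>" "exp u = (\<Sum>m<3. u ^ m / fact m) + exp t / fact 3 * u ^ 3"
    using Maclaurin_exp_le[of u 3] by blast
  have "exp t \<le> 3"
    using exp_le order_trans[of "exp t" "exp 1" 3] t(1) assms by auto
  have "exp u - (1 + u + u\<^sup>2 / 2) = exp t / 6 * u ^ 3"
    using t(2) by (simp add: numeral_3_eq_3 power2_eq_square)
  then have "\<bar>exp u - (1 + u + u\<^sup>2 / 2)\<bar> = exp t / 6 * \<bar>u\<bar> ^ 3"
    by (simp only: abs_mult power_abs abs_exp_cancel abs_divide abs_numeral)
  also have "\<dots> \<le> 1 * \<bar>u\<bar> ^ 3"
    using \<open>exp t \<le> 3\<close> by (intro mult_right_mono) auto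
  finally show ?thesis by simp
qed

lemma measurable_natural_filtration:
  assumes "i \<in> {1..n}"
  shows "X i \<in> borel_measurable (natural_filtration M X n)"
proof (rule measurableI)
  fix A :: "real set" assume "A \<in> sets borel"
  then have "X i -` A \<inter> space M \<in> (\<Union>i\<in>{1..n}. {X i -` A \<inter> space M | A. A \<in> sets borel})"
    using assms by blast
  then show "X i -` A \<inter> space (natural_filtration M X n) \<in> sets (natural_filtration M X n)"
    by (auto simp: natural_filtration_def space_measure_of_conv sets_measure_of_conv)
qed simp

section \<open>Exponential moments of bounded martingale difference sums\<close>

locale bounded_martingale_differences = prob_space M
  for M :: "'a measure" +
  fixes X :: "nat \<Rightarrow> 'a \<Rightarrow> real" and B :: real
  assumes measurable_X: "i \<ge> 1 \<Longrightarrow> X i \<in> borel_measurable M"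
    and bounded_X: "i \<ge> 1 \<Longrightarrow> AE \<omega> in M. \<bar>X i \<omega>\<bar> \<le> B"
    and cond_mean: "n \<ge> 1 \<Longrightarrow>
      AE \<omega> in M. real_cond_exp M (natural_filtration M X (n - 1)) (X n) \<omega> = 0"
    and cond_square: "n \<ge> 1 \<Longrightarrow>
      AE \<omega> in M. real_cond_exp M (natural_filtration M X (n - 1)) (\<lambda>\<omega>. (X n \<omega>)\<^sup>2) \<omega> = 1"
begin

definition S :: "nat \<Rightarrow> 'a \<Rightarrow> real" where
  "S n \<omega> = (\<Sum>i=1..n. X i \<omega>)"

lemma S_0 [simp]: "S 0 \<omega> = 0"
  by (simp add: S_def)

lemma S_Suc [simp]: "S (Suc n) \<omega> = S n \<omega> + X (Suc n) \<omega>"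
  by (simp add: S_def)

lemma bound_nonneg: "B \<ge> 0"
proof -
  have "AE \<omega> in M. B \<ge> 0" using bounded_X[OF order_refl] by eventually_elim auto
  then show ?thesis by simp
qed

lemma measurable_S [measurable]: "S n \<in> borel_measurable M"
  unfolding S_def using measurable_X by (intro borel_measurable_sum) auto

lemma AE_abs_S_le: "AE \<omega> in M. \<bar>S n \<omega>\<bar> \<le> n * B"
proof -
  have "AE \<omega> in M. \<forall>i\<in>{1..n}. \<bar>X i \<omega>\<bar> \<le> B"
    using bounded_X by (intro AE_finite_allI) auto
  then show ?thesis
  proof eventually_elim
    case (elim \<omega>)
    have "\<bar>S n \<omega>\<bar> \<le> (\<Sum>i=1..n. \<bar>X i \<omega>\<bar>)" 
      unfolding S_def by (rule sum_abs)
    also have "\<dots> \<le> (\<Sum>i=1..n. B)" using elim by (intro sum_mono) auto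
    finally show ?case by simp
  qed
qed

lemma AE_exp_S_le: "AE \<omega> in M. exp (l * S n \<omega>) \<le> exp (\<bar>l\<bar> * (n * B))"
  using AE_abs_S_le[of n]
proof eventually_elim
  case (elim \<omega>)
  have "l * S n \<omega> \<le> \<bar>l\<bar> * \<bar>S n \<omega>\<bar>" by (metis abs_ge_self abs_mult)
  also have "\<dots> \<le> \<bar>l\<bar> * (n * B)" using elim by (intro mult_left_mono) auto
  finally show ?case by simp
qed

text \<open>\<open>S n\<close> is almost surely bounded by n B, hence the integrand is almost surely
  bounded. The powers 0, 1 and 2 are those of the quadratic Taylor polynomial.\<close>

lemma integrable_exp_S_mult_power:
  "integrable M (\<lambda>\<omega>. exp (l * S n \<omega>) * X (Suc n) \<omega> ^ k)"
proof (rule integrable_const_bound)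
  show "AE \<omega> in M. norm (exp (l * S n \<omega>) * X (Suc n) \<omega> ^ k) \<le> exp (\<bar>l\<bar> * (n * B)) * B ^ k"
    using AE_exp_S_le[of l n] bounded_X[of "Suc n", simplified]
  proof eventually_elim
    case (elim \<omega>)
    have "norm (exp (l * S n \<omega>) * X (Suc n) \<omega> ^ k) = exp (l * S n \<omega>) * \<bar>X (Suc n) \<omega>\<bar> ^ k"
      by (simp add: abs_mult power_abs)
    also have "\<dots> \<le> exp (\<bar>l\<bar> * (n * B)) * B ^ k"
      using elim by (intro mult_mono power_mono) auto
    finally show ?case .
  qed
  have [measurable]: "X (Suc n) \<in> borel_measurable M" by (rule measurable_X) simp
  show "(\<lambda>\<omega>. exp (l * S n \<omega>) * X (Suc n) \<omega> ^ k) \<in> borel_measurable M"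
    by measurable
qed

lemma integrable_exp_S: "integrable M (\<lambda>\<omega>. exp (l * S n \<omega>))"
  using integrable_exp_S_mult_power[of l n 0] by simp

text \<open>exp (l S_n) is measurable for the sigma-algebra of the first \<open>n\<close> variables
  and may be pulled out of the conditional expectation. A general \<open>g\<close> serves both the
  next increment and its square.\<close>

lemma expectation_exp_S_mult:
  assumes g: "g \<in> borel_measurable M" "integrable M (\<lambda>\<omega>. exp (l * S n \<omega>) * g \<omega>)"
    and c: "AE \<omega> in M. real_cond_exp M (natural_filtration M X n) g \<omega> = c"
  shows "expectation (\<lambda>\<omega>. exp (l * S n \<omega>) * g \<omega>) = expectation (\<lambda>\<omega>. exp (l * S n \<omega>)) * c"
proof -
  have sub: "subalgebra M (natural_filtration M X n)"
    by (rule subalgebra_natural_filtration) (rule measurable_X)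
  interpret F: finite_measure_subalgebra M "natural_filtration M X n"
    by standard (rule sub)
  have [measurable]: "S n \<in> borel_measurable (natural_filtration M X n)"
    unfolding S_def by (intro borel_measurable_sum measurable_natural_filtration)
  have meas: "(\<lambda>\<omega>. exp (l * S n \<omega>)) \<in> borel_measurable (natural_filtration M X n)"
    by measurable
  have "expectation (\<lambda>\<omega>. exp (l * S n \<omega>) * g \<omega>)
      = expectation (\<lambda>\<omega>. exp (l * S n \<omega>) * real_cond_exp M (natural_filtration M X n) g \<omega>)"
    using F.real_cond_exp_intg(2)[OF g(2) meas g(1)] by simp
  also have "\<dots> = expectation (\<lambda>\<omega>. exp (l * S n \<omega>) * c)"
    using c by (intro integral_cong_AE) auto
  finally show ?thesis by simp
qed

text \<open>Since \<open>\<bar>lx\<bar>\<^sup>3 \<le> \<bar>l\<bar>\<^sup>3Bx\<^sup>2\<close> for \<open>\<bar>x\<bar> \<le> B\<close>, the quadratic Taylor bounds for \<open>exp (l * x)\<close> are combinations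
  of \<open>1\<close>, \<open>x\<close> and \<open>x\<^sup>2\<close> only, whose conditional means are prescribed.\<close>

lemma mgf_S_Suc:
  assumes "\<bar>l\<bar> * B \<le> 1"
  defines "m \<equiv> \<lambda>n. expectation (\<lambda>\<omega>. exp (l * S n \<omega>))"
  shows "m n * (1 + l\<^sup>2 / 2 - \<bar>l\<bar> ^ 3 * B) \<le> m (Suc n)"
    and "m (Suc n) \<le> m n * (1 + l\<^sup>2 / 2 + \<bar>l\<bar> ^ 3 * B)"
proof -
  note int = integrable_exp_S_mult_power[of l n 1, simplified]
    integrable_exp_S_mult_power[of l n 2] integrable_exp_S
  have Xm [measurable]: "X (Suc n) \<in> borel_measurable M" by (rule measurable_X) simp
  \<comment> \<open>At index \<open>Suc n\<close> the hypotheses condition on the sigma-algebra of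
    index \<open>n\<close>, for which \<open>S n\<close> is measurable.\<close>
  have first: "expectation (\<lambda>\<omega>. exp (l * S n \<omega>) * X (Suc n) \<omega>) = 0"
    using expectation_exp_S_mult[OF Xm int(1), of 0] cond_mean[of "Suc n"] by simp
  have second: "expectation (\<lambda>\<omega>. exp (l * S n \<omega>) * (X (Suc n) \<omega>)\<^sup>2) = m n"
    using expectation_exp_S_mult[OF _ int(2), of 1] cond_square[of "Suc n"] by (simp add: m_def)
  \<comment> \<open>Taylor polynomial of the new factor, times exp (l S_n), with its quadratic
    coefficient perturbed by \<open>s\<close>. The two signs of the cubic error, taken as
    \<open>s\<close>, give a minorant and a majorant.\<close>
  define q where "q = (\<lambda>s \<omega>. exp (l * S n \<omega>) + l * (exp (l * S n \<omega>) * X (Suc n) \<omega>)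
      + (l\<^sup>2 / 2 + s) * (exp (l * S n \<omega>) * (X (Suc n) \<omega>)\<^sup>2))"
  have q_int: "integrable M (q s)" for s
    unfolding q_def by (intro Bochner_Integration.integrable_add integrable_mult_right int)
  have q_exp: "expectation (q s) = m n * (1 + l\<^sup>2 / 2 + s)" for s
    unfolding q_def using int first second
    by (simp add: m_def algebra_simps)
  have *: "AE \<omega> in M. q (- (\<bar>l\<bar> ^ 3 * B)) \<omega> \<le> exp (l * S (Suc n) \<omega>)
      \<and> exp (l * S (Suc n) \<omega>) \<le> q (\<bar>l\<bar> ^ 3 * B) \<omega>"
    using bounded_X[of "Suc n", simplified]
  proof eventually_elim
    case (elim \<omega>)
    define x where "x = X (Suc n) \<omega>"
    have lx: "\<bar>l * x\<bar> \<le> \<bar>l\<bar> * B"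
      using elim by (simp add: x_def abs_mult mult_left_mono)
    have "\<bar>l * x\<bar> ^ 3 = \<bar>l\<bar> ^ 3 * x\<^sup>2 * \<bar>x\<bar>"
      unfolding power2_abs[of x, symmetric]
      by (simp only: abs_mult power3_eq_cube power2_eq_square mult_ac)
    also have "\<dots> \<le> \<bar>l\<bar> ^ 3 * x\<^sup>2 * B"
      using elim by (intro mult_left_mono) (auto simp: x_def)
    finally have "\<bar>exp (l * x) - (1 + l * x + (l * x)\<^sup>2 / 2)\<bar> \<le> \<bar>l\<bar> ^ 3 * B * x\<^sup>2"
      using exp_quadratic_error[of "l * x"] lx assms(1) by (simp add: mult_ac)
    then have b: "1 + l * x + (l\<^sup>2 / 2 + - (\<bar>l\<bar> ^ 3 * B)) * x\<^sup>2 \<le> exp (l * x)"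
      "exp (l * x) \<le> 1 + l * x + (l\<^sup>2 / 2 + \<bar>l\<bar> ^ 3 * B) * x\<^sup>2"
      by (auto simp: abs_le_iff algebra_simps power_mult_distrib)
    have e: "exp (l * S (Suc n) \<omega>) = exp (l * S n \<omega>) * exp (l * x)"
      by (simp add: x_def exp_add[symmetric] algebra_simps)
    have qe: "q s \<omega> = exp (l * S n \<omega>) * (1 + l * x + (l\<^sup>2 / 2 + s) * x\<^sup>2)" for s
      by (simp add: q_def x_def algebra_simps)
    show ?case unfolding e qe using b by (auto intro!: mult_left_mono)
  qed
  have "expectation (q (- (\<bar>l\<bar> ^ 3 * B))) \<le> m (Suc n)"
    unfolding m_def using * by (intro integral_mono_AE q_int int) auto
  then show "m n * (1 + l\<^sup>2 / 2 - \<bar>l\<bar> ^ 3 * B) \<le> m (Suc n)" by (simp add: q_exp)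
  have "m (Suc n) \<le> expectation (q (\<bar>l\<bar> ^ 3 * B))"
    unfolding m_def using * by (intro integral_mono_AE q_int int) auto
  then show "m (Suc n) \<le> m n * (1 + l\<^sup>2 / 2 + \<bar>l\<bar> ^ 3 * B)" by (simp add: q_exp)
qed

text \<open>The one-step bounds are iterated from E exp (l S_0) = 1. Since |l| B \<le> 1/2, the
  cubic error is at most l^2/2, so the lower factor is nonnegative and the inequalities may be
  multiplied.\<close>

lemma mgf_S_bounds:
  assumes "\<bar>l\<bar> * B \<le> 1 / 2"
  shows "(1 + l\<^sup>2 / 2 - \<bar>l\<bar> ^ 3 * B) ^ n \<le> expectation (\<lambda>\<omega>. exp (l * S n \<omega>))"
    and "expectation (\<lambda>\<omega>. exp (l * S n \<omega>)) \<le> (1 + l\<^sup>2 / 2 + \<bar>l\<bar> ^ 3 * B) ^ n"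
proof -
  have "\<bar>l\<bar> ^ 3 * B = l\<^sup>2 * (\<bar>l\<bar> * B)" by (simp add: power3_eq_cube power2_eq_square)
  also have "\<dots> \<le> l\<^sup>2 * (1 / 2)" using assms by (intro mult_left_mono) auto
  finally have lower_pos: "1 + l\<^sup>2 / 2 - \<bar>l\<bar> ^ 3 * B \<ge> 0" by simp
  have upper_pos: "1 + l\<^sup>2 / 2 + \<bar>l\<bar> ^ 3 * B \<ge> 0"
    using bound_nonneg by (simp add: add_nonneg_nonneg)
  show "(1 + l\<^sup>2 / 2 - \<bar>l\<bar> ^ 3 * B) ^ n \<le> expectation (\<lambda>\<omega>. exp (l * S n \<omega>))"
  proof (induction n)
    case (Suc n)
    then have "(1 + l\<^sup>2 / 2 - \<bar>l\<bar> ^ 3 * B) ^ Suc n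
        \<le> expectation (\<lambda>\<omega>. exp (l * S n \<omega>)) * (1 + l\<^sup>2 / 2 - \<bar>l\<bar> ^ 3 * B)"
      unfolding power_Suc2 using lower_pos by (rule mult_right_mono)
    also have "\<dots> \<le> expectation (\<lambda>\<omega>. exp (l * S (Suc n) \<omega>))"
      using assms by (intro mgf_S_Suc) simp
    finally show ?case .
  qed (simp add: prob_space)
  show "expectation (\<lambda>\<omega>. exp (l * S n \<omega>)) \<le> (1 + l\<^sup>2 / 2 + \<bar>l\<bar> ^ 3 * B) ^ n"
  proof (induction n)
    case (Suc n)
    have "expectation (\<lambda>\<omega>. exp (l * S (Suc n) \<omega>))
        \<le> expectation (\<lambda>\<omega>. exp (l * S n \<omega>)) * (1 + l\<^sup>2 / 2 + \<bar>l\<bar> ^ 3 * B)"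
      using assms by (intro mgf_S_Suc) simp
    also have "\<dots> \<le> (1 + l\<^sup>2 / 2 + \<bar>l\<bar> ^ 3 * B) ^ Suc n"
      unfolding power_Suc2 using Suc upper_pos by (rule mult_right_mono)
    finally show ?case .
  qed (simp add: prob_space)
qed

text \<open>Applies u / (1 + u) \<le> ln (1 + u) \<le> u to the factor of each step; in the lower
  bound the denominator is enlarged to 1 + l^2/2.\<close>

lemma ln_mgf_S_bounds:
  assumes "\<bar>l\<bar> * B \<le> 1 / 2"
  shows "n * ((l\<^sup>2 / 2 - \<bar>l\<bar> ^ 3 * B) / (1 + l\<^sup>2 / 2)) \<le> ln (expectation (\<lambda>\<omega>. exp (l * S n \<omega>)))"
    and "ln (expectation (\<lambda>\<omega>. exp (l * S n \<omega>))) \<le> n * (l\<^sup>2 / 2 + \<bar>l\<bar> ^ 3 * B)"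
proof -
  define c where "c = \<bar>l\<bar> ^ 3 * B"
  have "c = l\<^sup>2 * (\<bar>l\<bar> * B)" by (simp add: c_def power3_eq_cube power2_eq_square)
  also have "\<dots> \<le> l\<^sup>2 * (1 / 2)" using assms by (intro mult_left_mono) auto
  finally have c: "0 \<le> c" "c \<le> l\<^sup>2 / 2" using bound_nonneg by (auto simp: c_def)
  define u where "u = l\<^sup>2 / 2 - c"
  have u: "u \<ge> 0" "u \<le> l\<^sup>2 / 2" using c by (auto simp: u_def)
  note b = mgf_S_bounds[OF assms, of n, folded c_def]
  have pos: "(1 + u) ^ n > 0" using u by simp
  have le: "(1 + u) ^ n \<le> expectation (\<lambda>\<omega>. exp (l * S n \<omega>))"
    using b(1) by (simp add: u_def algebra_simps)
  have "u / (1 + l\<^sup>2 / 2) \<le> u / (1 + u)"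
    using u by (intro divide_left_mono mult_pos_pos) auto
  also have "\<dots> \<le> ln (1 + u)"
  proof -
    \<comment> \<open>This is ln y \<le> y - 1 at the reciprocal of 1 + u.\<close>
    have "ln (1 / (1 + u)) \<le> 1 / (1 + u) - 1" using u by (intro ln_le_minus_one) auto
    then show ?thesis using u by (simp add: ln_div field_simps)
  qed
  finally have "n * (u / (1 + l\<^sup>2 / 2)) \<le> n * ln (1 + u)" by (intro mult_left_mono) auto
  also have "\<dots> = ln ((1 + u) ^ n)" by (simp add: ln_realpow)
  also have "\<dots> \<le> ln (expectation (\<lambda>\<omega>. exp (l * S n \<omega>)))"
    using pos le by simp
  finally show "n * ((l\<^sup>2 / 2 - \<bar>l\<bar> ^ 3 * B) / (1 + l\<^sup>2 / 2)) \<le> ln (expectation (\<lambda>\<omega>. exp (l * S n \<omega>)))"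
    by (simp add: u_def c_def)
  have "ln (expectation (\<lambda>\<omega>. exp (l * S n \<omega>))) \<le> ln ((1 + (l\<^sup>2 / 2 + c)) ^ n)"
    using b(2) pos le by (subst ln_le_cancel_iff) (auto simp: add.assoc)
  also have "\<dots> = n * ln (1 + (l\<^sup>2 / 2 + c))" by (rule ln_realpow)
  also have "\<dots> \<le> n * (l\<^sup>2 / 2 + c)"
    using c by (intro mult_left_mono ln_add_one_self_le_self) auto
  finally show "ln (expectation (\<lambda>\<omega>. exp (l * S n \<omega>))) \<le> n * (l\<^sup>2 / 2 + \<bar>l\<bar> ^ 3 * B)"
    by (simp add: c_def)
qed

text \<open>With l_n = t a_n / sqrt n the quotient n l_n^2 / a_n^2 is exactly t^2. The remaining
  errors, |l_n| B and the denominator 1 + l_n^2/2, disappear because l_n tends to 0.\<close>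

lemma log_mgf_S_limit:
  assumes a_pos: "\<And>n. n \<ge> 1 \<Longrightarrow> a n > 0"
    and a_small: "(\<lambda>n. a n / sqrt (real n)) \<longlonglongrightarrow> 0"
  shows "(\<lambda>n. ln (expectation (\<lambda>\<omega>. exp (t * (a n / sqrt n) * S n \<omega>))) / (a n)\<^sup>2) \<longlonglongrightarrow> t\<^sup>2 / 2"
proof -
  define l where "l = (\<lambda>n. t * (a n / sqrt (real n)))"
  have l0: "l \<longlonglongrightarrow> 0" unfolding l_def using tendsto_mult_right_zero[OF a_small] .
  have "(\<lambda>n. \<bar>l n\<bar> * B) \<longlonglongrightarrow> 0"
    using l0 by (intro tendsto_mult_left_zero tendsto_rabs_zero)
  then have small: "\<forall>\<^sub>F n in sequentially. \<bar>l n\<bar> * B < 1 / 2"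
    by (rule order_tendstoD) simp
  have scale: "n * (l n)\<^sup>2 / (a n)\<^sup>2 = t\<^sup>2" if "n \<ge> 1" for n
    using that a_pos[OF that] by (simp add: l_def power_mult_distrib power_divide)
  have cube: "\<bar>x\<bar> ^ 3 = x\<^sup>2 * \<bar>x\<bar>" for x :: real
    by (simp add: power3_eq_cube power2_eq_square)
  show ?thesis
  proof (rule tendsto_sandwich)
    show "\<forall>\<^sub>F n in sequentially. t\<^sup>2 * ((1 / 2 - \<bar>l n\<bar> * B) / (1 + (l n)\<^sup>2 / 2))
      \<le> ln (expectation (\<lambda>\<omega>. exp (t * (a n / sqrt n) * S n \<omega>))) / (a n)\<^sup>2"
      using small eventually_ge_at_top[of 1]
    proof eventually_elim
      case (elim n)
      have "t\<^sup>2 * ((1 / 2 - \<bar>l n\<bar> * B) / (1 + (l n)\<^sup>2 / 2))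
        = n * (((l n)\<^sup>2 / 2 - \<bar>l n\<bar> ^ 3 * B) / (1 + (l n)\<^sup>2 / 2)) / (a n)\<^sup>2"
        unfolding scale[OF elim(2), symmetric] cube by (simp add: algebra_simps diff_divide_distrib)
      also have "\<dots> \<le> ln (expectation (\<lambda>\<omega>. exp (l n * S n \<omega>))) / (a n)\<^sup>2"
        using elim by (intro divide_right_mono ln_mgf_S_bounds) auto
      finally show ?case by (simp add: l_def)
    qed
    show "\<forall>\<^sub>F n in sequentially. ln (expectation (\<lambda>\<omega>. exp (t * (a n / sqrt n) * S n \<omega>))) / (a n)\<^sup>2
      \<le> t\<^sup>2 * (1 / 2 + \<bar>l n\<bar> * B)"
      using small eventually_ge_at_top[of 1]
    proof eventually_elim
      case (elim n)
      have "ln (expectation (\<lambda>\<omega>. exp (l n * S n \<omega>))) / (a n)\<^sup>2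
        \<le> n * ((l n)\<^sup>2 / 2 + \<bar>l n\<bar> ^ 3 * B) / (a n)\<^sup>2"
        using elim by (intro divide_right_mono ln_mgf_S_bounds) auto
      also have "\<dots> = t\<^sup>2 * (1 / 2 + \<bar>l n\<bar> * B)"
        unfolding scale[OF elim(2), symmetric] cube by (simp add: algebra_simps add_divide_distrib)
      finally show ?case by (simp add: l_def)
    qed
    have "(\<lambda>n. t\<^sup>2 * ((1 / 2 - \<bar>l n\<bar> * B) / (1 + (l n)\<^sup>2 / 2)))
        \<longlonglongrightarrow> t\<^sup>2 * ((1 / 2 - \<bar>0\<bar> * B) / (1 + 0\<^sup>2 / 2))"
      by (intro tendsto_intros l0) auto
    then show "(\<lambda>n. t\<^sup>2 * ((1 / 2 - \<bar>l n\<bar> * B) / (1 + (l n)\<^sup>2 / 2))) \<longlonglongrightarrow> t\<^sup>2 / 2" by simp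
    have "(\<lambda>n. t\<^sup>2 * (1 / 2 + \<bar>l n\<bar> * B)) \<longlonglongrightarrow> t\<^sup>2 * (1 / 2 + \<bar>0\<bar> * B)"
      by (intro tendsto_intros l0)
    then show "(\<lambda>n. t\<^sup>2 * (1 / 2 + \<bar>l n\<bar> * B)) \<longlonglongrightarrow> t\<^sup>2 / 2" by simp
  qed
qed

end

section \<open>Moderate deviations of the normalised sums\<close>

theorem theorem2p3:
  fixes M :: "'a measure" and X :: "nat \<Rightarrow> 'a \<Rightarrow> real" and B :: real and a :: "nat \<Rightarrow> real"
  assumes "prob_space M"
    and "\<And>i. i \<ge> 1 \<Longrightarrow> X i \<in> borel_measurable M"
    and "\<And>i. i \<ge> 1 \<Longrightarrow> AE \<omega> in M. \<bar>X i \<omega>\<bar> \<le> B"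
    and "\<And>n. n \<ge> 1 \<Longrightarrow>
           AE \<omega> in M. real_cond_exp M (natural_filtration M X (n - 1)) (X n) \<omega> = 0"
    and "\<And>n. n \<ge> 1 \<Longrightarrow>
           AE \<omega> in M. real_cond_exp M (natural_filtration M X (n - 1)) (\<lambda>\<omega>. (X n \<omega>)\<^sup>2) \<omega> = 1"
    and "\<And>n. n \<ge> 1 \<Longrightarrow> a n > 0"
    and "filterlim a at_top sequentially"
    and "(\<lambda>n. a n / sqrt (real n)) \<longlonglongrightarrow> 0"
  shows "satisfies_MDP M (\<lambda>n \<omega>. (1 / (a n * sqrt (real n))) * (\<Sum>i=1..n. X i \<omega>))
           (\<lambda>n. (a n)\<^sup>2) (\<lambda>x. ereal (x\<^sup>2 / 2))"
proof -
  interpret prob_space M by fact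
  interpret bounded_martingale_differences M X B
    by standard (use assms in auto)
  \<comment> \<open>The speed a_n^2 turns the scaled exponent into l_n S_n. The identity also holds
    where a denominator vanishes, as division by 0 gives 0.\<close>
  have exponent: "(a n)\<^sup>2 * t * (1 / (a n * sqrt n) * s) = t * (a n / sqrt n) * s" for n t s
    by (simp add: power2_eq_square)
  interpret gaussian_log_mgf M "\<lambda>n \<omega>. (1 / (a n * sqrt (real n))) * S n \<omega>" "\<lambda>n. (a n)\<^sup>2"
  proof
    show "filterlim (\<lambda>n. (a n)\<^sup>2) at_top sequentially"
      using assms(7) by (intro filterlim_pow_at_top) auto
  qed (unfold exponent, measurable, rule integrable_exp_S, rule log_mgf_S_limit[OF assms(6,8)])
  show ?thesis using LDP unfolding S_def .
qed

end
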